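(* For any range map $\delta$, the space $\mathcal{V}_\delta$ is an operad ideal of the operad $\mathbf{Cl}_{\bar{\delta}}$ if and only if $\delta$ is unimodal.
   Context: $\mathbb{N}=\{0,1,2,\dots\}$ and $\mathbb{K}$ is a field of characteristic zero. Operads are nonsymmetric operads in $\mathbb{K}$-vector spaces, with partial compositions $\circ_i$ and a unit; an operad ideal of an operad $\mathcal{O}$ is a graded subspace $\mathcal{V}$ such that $f\circ_i g\in\mathcal{V}$ whenever $f,g$ are homogeneous and $f\in\mathcal{V}$ or $g\in\mathcal{V}$. A range map is a map $\delta:\mathbb{N}\setminus\{0\}\to\mathbb{N}$. It is unimodal if there are no $1\le i_1<i_2<i_3$ with $\delta(i_1)>\delta(i_2)<\delta(i_3)$. For a range map $\delta$, let $\bar{\delta}$ be the (weakly increasing) range map $\bar{\delta}(i):=\max\{\delta(1),\dots,\delta(i)\}$. For a word $w$ on $\mathbb{N}$, $\ell(w)$ is its length, $w(i)$ its $i$-th letter, and $\epsilon$ is the empty word. A $\delta$-cliff is a word $w$ on $\mathbb{N}$ such that $0\le w(i)\le\delta(i)$ for all $1\le i\le\ell(w)$. Its size is $|w|:=\ell(w)+1$. $\mathsf{Cl}_\delta$ is the graded set (by size) of all $\delta$-cliffs; note $\mathsf{Cl}_\delta\subseteq\mathsf{Cl}_{\bar\delta}$. For words $u,v$ and $1\le i\le |u|$, set $u\,\square_i\,v:=u(1)\cdots u(i-1)\;v\;u(i)\cdots u(\ell(u))$ (insertion of $v$ into $u$ just before its $i$-th letter, or at the end if $i=|u|$). For a weakly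 increasing range map $\rho$, $\mathbf{Cl}_\rho$ is the operad with basis $\{\mathsf{E}_w:w\in\mathsf{Cl}_\rho\}$, where $\mathsf{E}_w$ has arity $|w|$, partial compositions given by $\mathsf{E}_u\circ_i\mathsf{E}_v:=\mathsf{E}_{u\,\square_i\,v}$, and unit $\mathsf{E}_\epsilon$. $\mathcal{V}_\delta$ is the graded subspace of $\mathbf{Cl}_{\bar\delta}$ spanned by $\{\mathsf{E}_w: w\in\mathsf{Cl}_{\bar\delta}\setminus\mathsf{Cl}_\delta\}$. *)

theory Defs
  imports Complex_Main "HOL-Library.Poly_Mapping"
begin

section \<open>Nonsymmetric operads and operad ideals\<close>

text \<open>
  The graded vector space underlying an operad is the internal direct sum of its homogeneous
  components \<open>arity_part P n\<close> inside the ambient type \<open>'a\<close>. The term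
  \<open>pcomp P f i g\<close> is the partial composition of \<open>f\<close> and \<open>g\<close> at the input
  \<open>i\<close>; its value matters only for homogeneous \<open>f\<close>, \<open>g\<close> and
  \<open>1 \<le> i \<le> m\<close>, where \<open>m\<close> is the arity of \<open>f\<close>.
\<close>

record ('k, 'a) operad =
  smult :: "'k \<Rightarrow> 'a \<Rightarrow> 'a"
  arity_part :: "nat \<Rightarrow> 'a set"
  pcomp :: "'a \<Rightarrow> nat \<Rightarrow> 'a \<Rightarrow> 'a"
  operad_unit :: "'a"

locale ns_operad = vector_space "smult P"
  for P :: "('k::field, 'a::ab_group_add) operad" +
  assumes part_subspace: "module.subspace (smult P) (arity_part P n)"
    and part_direct:
      "\<lbrakk>finite N; \<And>n. n \<in> N \<Longrightarrow> x n \<in> arity_part P n; (\<Sum>n\<in>N. x n) = 0; k \<in> N\<rbrakk>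
        \<Longrightarrow> x k = 0"
    and pcomp_closed:
      "\<lbrakk>f \<in> arity_part P m; g \<in> arity_part P n; 1 \<le> i; i \<le> m\<rbrakk>
        \<Longrightarrow> pcomp P f i g \<in> arity_part P (m + n - 1)"
    and pcomp_add_left:
      "\<lbrakk>f \<in> arity_part P m; f' \<in> arity_part P m; g \<in> arity_part P n; 1 \<le> i; i \<le> m\<rbrakk>
        \<Longrightarrow> pcomp P (f + f') i g = pcomp P f i g + pcomp P f' i g"
    and pcomp_add_right:
      "\<lbrakk>f \<in> arity_part P m; g \<in> arity_part P n; g' \<in> arity_part P n; 1 \<le> i; i \<le> m\<rbrakk>
        \<Longrightarrow> pcomp P f i (g + g') = pcomp P f i g + pcomp P f i g'"
    and pcomp_smult_left:
      "\<lbrakk>f \<in> arity_part P m; g \<in> arity_part P n; 1 \<le> i; i \<le> m\<rbrakk>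
        \<Longrightarrow> pcomp P (smult P c f) i g = smult P c (pcomp P f i g)"
    and pcomp_smult_right:
      "\<lbrakk>f \<in> arity_part P m; g \<in> arity_part P n; 1 \<le> i; i \<le> m\<rbrakk>
        \<Longrightarrow> pcomp P f i (smult P c g) = smult P c (pcomp P f i g)"
    and pcomp_sequential:
      "\<lbrakk>f \<in> arity_part P m; g \<in> arity_part P n; h \<in> arity_part P l;
        1 \<le> i; i \<le> m; 1 \<le> j; j \<le> n\<rbrakk>
        \<Longrightarrow> pcomp P (pcomp P f i g) (i + j - 1) h = pcomp P f i (pcomp P g j h)"
    and pcomp_parallel:
      "\<lbrakk>f \<in> arity_part P m; g \<in> arity_part P n; h \<in> arity_part P l;
        1 \<le> i; i < j; j \<le> m\<rbrakk>
        \<Longrightarrow> pcomp P (pcomp P f i g) (j + n - 1) h = pcomp P (pcomp P f j h) i g"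
    and unit_closed: "operad_unit P \<in> arity_part P 1"
    and pcomp_unit_left: "f \<in> arity_part P m \<Longrightarrow> pcomp P (operad_unit P) 1 f = f"
    and pcomp_unit_right:
      "\<lbrakk>f \<in> arity_part P m; 1 \<le> i; i \<le> m\<rbrakk> \<Longrightarrow> pcomp P f i (operad_unit P) = f"

text \<open>
  The assumption \<open>ideal_graded\<close> says that \<open>V\<close> is the sum of its homogeneous parts;
  in particular \<open>V\<close> is contained in the space of \<open>P\<close>.
\<close>

locale operad_ideal = ns_operad P
  for P :: "('k::field, 'a::ab_group_add) operad" and V :: "'a set" +
  assumes ideal_subspace: "module.subspace (smult P) V"
    and ideal_graded: "V \<subseteq> module.span (smult P) (\<Union>n. V \<inter> arity_part P n)"
    and ideal_pcomp:
      "\<lbrakk>f \<in> arity_part P m; g \<in> arity_part P n; 1 \<le> i; i \<le> m; f \<in> V \<or> g \<in> V\<rbrakk>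
        \<Longrightarrow> pcomp P f i g \<in> V"


section \<open>Range maps and cliffs\<close>

text \<open>
  A range map is a function on the positive integers, represented by a function of type
  \<open>nat \<Rightarrow> nat\<close>. Its value at \<open>0\<close> is irrelevant: it is not used below.
\<close>

definition unimodal :: "(nat \<Rightarrow> nat) \<Rightarrow> bool" where
  "unimodal \<delta> \<longleftrightarrow>
    \<not> (\<exists>i1 i2 i3. 1 \<le> i1 \<and> i1 < i2 \<and> i2 < i3 \<and> \<delta> i1 > \<delta> i2 \<and> \<delta> i2 < \<delta> i3)"

definition weakly_increasing :: "(nat \<Rightarrow> nat) \<Rightarrow> bool" where
  "weakly_increasing \<rho> \<longleftrightarrow> (\<forall>i j. 1 \<le> i \<and> i \<le> j \<longrightarrow> \<rho> i \<le> \<rho> j)"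

definition range_bar :: "(nat \<Rightarrow> nat) \<Rightarrow> nat \<Rightarrow> nat" where
  "range_bar \<delta> i = Max (\<delta> ` {1..i})"

definition letter :: "nat list \<Rightarrow> nat \<Rightarrow> nat" where
  "letter w i = w ! (i - 1)"

definition cliffs :: "(nat \<Rightarrow> nat) \<Rightarrow> nat list set" where
  "cliffs \<delta> = {w. \<forall>i. 1 \<le> i \<and> i \<le> length w \<longrightarrow> letter w i \<le> \<delta> i}"

definition cliff_size :: "nat list \<Rightarrow> nat" where
  "cliff_size w = length w + 1"

definition word_insert :: "nat list \<Rightarrow> nat \<Rightarrow> nat list \<Rightarrow> nat list" where
  "word_insert u i v = take (i - 1) u @ v @ drop (i - 1) u"


section \<open>The operads of cliffs\<close>

text \<open>
  All these operads live in the vector space \<open>nat list \<Rightarrow>\<^sub>0 'k\<close> with basis the set of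
  all words.
\<close>

definition lin_smult :: "'k::field \<Rightarrow> (nat list \<Rightarrow>\<^sub>0 'k) \<Rightarrow> (nat list \<Rightarrow>\<^sub>0 'k)" where
  "lin_smult c = Poly_Mapping.map ((*) c)"

definition E :: "nat list \<Rightarrow> (nat list \<Rightarrow>\<^sub>0 'k::field)" where
  "E w = Poly_Mapping.single w 1"

text \<open>The bilinear extension of word insertion; see \<open>lin_pcomp_E\<close>.\<close>

definition lin_pcomp ::
    "(nat list \<Rightarrow>\<^sub>0 'k::field) \<Rightarrow> nat \<Rightarrow> (nat list \<Rightarrow>\<^sub>0 'k) \<Rightarrow> (nat list \<Rightarrow>\<^sub>0 'k)" where
  "lin_pcomp f i g =
    (\<Sum>u\<in>Poly_Mapping.keys f. \<Sum>v\<in>Poly_Mapping.keys g.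
      lin_smult (Poly_Mapping.lookup f u * Poly_Mapping.lookup g v) (E (word_insert u i v)))"

text \<open>This is an operad when \<open>\<rho>\<close> is weakly increasing; see \<open>ns_operad_cliff_operad\<close>.\<close>

definition cliff_operad :: "(nat \<Rightarrow> nat) \<Rightarrow> ('k::field, nat list \<Rightarrow>\<^sub>0 'k) operad" where
  "cliff_operad \<rho> =
    \<lparr>smult = lin_smult,
     arity_part = (\<lambda>n. module.span lin_smult (E ` {w \<in> cliffs \<rho>. cliff_size w = n})),
     pcomp = lin_pcomp,
     operad_unit = E []\<rparr>"

definition cliff_V :: "(nat \<Rightarrow> nat) \<Rightarrow> (nat list \<Rightarrow>\<^sub>0 'k::field) set" where
  "cliff_V \<delta> = module.span lin_smult (E ` (cliffs (range_bar \<delta>) - cliffs \<delta>))"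


section \<open>Basic facts\<close>

lemma lookup_lin_smult: "Poly_Mapping.lookup (lin_smult c f) w = c * Poly_Mapping.lookup f w"
  by (simp add: lin_smult_def Poly_Mapping.map.rep_eq when_def)

lemma vector_space_lin_smult: "vector_space lin_smult"
  by unfold_locales
    (auto intro!: poly_mapping_eqI simp: lookup_lin_smult lookup_add algebra_simps)

interpretation lin: vector_space lin_smult
  by (rule vector_space_lin_smult)

lemma lookup_E: "Poly_Mapping.lookup (E w) u = (if u = w then 1 else 0)"
  by (auto simp: E_def lookup_single when_def)

lemma keys_E: "Poly_Mapping.keys (E w :: nat list \<Rightarrow>\<^sub>0 'k::field) = {w}"
  by (simp add: E_def)

lemma lin_pcomp_superset:
  assumes "finite A" "Poly_Mapping.keys f \<subseteq> A" "finite B" "Poly_Mapping.keys g \<subseteq> B"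
  shows "lin_pcomp f i g = (\<Sum>u\<in>A. \<Sum>v\<in>B.
    lin_smult (Poly_Mapping.lookup f u * Poly_Mapping.lookup g v) (E (word_insert u i v)))"
proof -
  have "lin_pcomp f i g = (\<Sum>u\<in>Poly_Mapping.keys f. \<Sum>v\<in>B.
    lin_smult (Poly_Mapping.lookup f u * Poly_Mapping.lookup g v) (E (word_insert u i v)))"
    unfolding lin_pcomp_def
    by (intro sum.cong refl sum.mono_neutral_left assms) (auto simp: in_keys_iff)
  also have "\<dots> = (\<Sum>u\<in>A. \<Sum>v\<in>B.
    lin_smult (Poly_Mapping.lookup f u * Poly_Mapping.lookup g v) (E (word_insert u i v)))"
    by (intro sum.mono_neutral_left assms) (auto simp: in_keys_iff)
  finally show ?thesis .
qed

lemma lin_pcomp_E: "lin_pcomp (E u) i (E v) = E (word_insert u i v)"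
  by (simp add: lin_pcomp_def keys_E lookup_E)

lemma lin_pcomp_add_left: "lin_pcomp (f + f') i g = lin_pcomp f i g + lin_pcomp f' i g"
proof -
  let ?A = "Poly_Mapping.keys f \<union> Poly_Mapping.keys f' \<union> Poly_Mapping.keys (f + f')"
  let ?B = "Poly_Mapping.keys g"
  show ?thesis
    by (subst (1 2 3) lin_pcomp_superset[of ?A _ ?B])
      (auto simp: lookup_add distrib_right lin.scale_left_distrib sum.distrib)
qed

lemma lin_pcomp_add_right: "lin_pcomp f i (g + g') = lin_pcomp f i g + lin_pcomp f i g'"
proof -
  let ?B = "Poly_Mapping.keys g \<union> Poly_Mapping.keys g' \<union> Poly_Mapping.keys (g + g')"
  let ?A = "Poly_Mapping.keys f"
  show ?thesis
    by (subst (1 2 3) lin_pcomp_superset[of ?A _ ?B])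
      (auto simp: lookup_add distrib_left lin.scale_left_distrib sum.distrib)
qed

lemma lin_pcomp_smult_left: "lin_pcomp (lin_smult c f) i g = lin_smult c (lin_pcomp f i g)"
proof -
  let ?A = "Poly_Mapping.keys f \<union> Poly_Mapping.keys (lin_smult c f)"
  let ?B = "Poly_Mapping.keys g"
  show ?thesis
    by (subst (1 2) lin_pcomp_superset[of ?A _ ?B])
      (auto simp: lookup_lin_smult lin.scale_sum_right mult.assoc)
qed

lemma lin_pcomp_smult_right: "lin_pcomp f i (lin_smult c g) = lin_smult c (lin_pcomp f i g)"
proof -
  let ?B = "Poly_Mapping.keys g \<union> Poly_Mapping.keys (lin_smult c g)"
  let ?A = "Poly_Mapping.keys f"
  show ?thesis
    by (subst (1 2) lin_pcomp_superset[of ?A _ ?B])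
      (auto simp: lookup_lin_smult lin.scale_sum_right mult_ac)
qed

lemma lin_pcomp_zero_left: "lin_pcomp 0 i g = 0"
  by (simp add: lin_pcomp_def)

lemma lin_pcomp_zero_right: "lin_pcomp f i 0 = 0"
  by (simp add: lin_pcomp_def)

lemmas lin_pcomp_linear = lin_pcomp_add_left lin_pcomp_add_right lin_pcomp_smult_left
  lin_pcomp_smult_right lin_pcomp_zero_left lin_pcomp_zero_right

lemma span_E_eq: "lin.span (E ` S) = {f. Poly_Mapping.keys f \<subseteq> S}"
proof (intro equalityI subsetI)
  fix f :: "nat list \<Rightarrow>\<^sub>0 'a" assume "f \<in> lin.span (E ` S)"
  then show "f \<in> {f. Poly_Mapping.keys f \<subseteq> S}"
  proof (rule lin.span_induct)
    show "lin.subspace {f. f \<in> {f::nat list \<Rightarrow>\<^sub>0 'a. Poly_Mapping.keys f \<subseteq> S}}"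
      unfolding lin.subspace_def
      by (auto simp: in_keys_iff lookup_add lookup_lin_smult subset_iff)
        (metis add.right_neutral)
  qed (auto simp: keys_E)
next
  fix f :: "nat list \<Rightarrow>\<^sub>0 'a" assume f: "f \<in> {f. Poly_Mapping.keys f \<subseteq> S}"
  have "f = (\<Sum>w\<in>Poly_Mapping.keys f. lin_smult (Poly_Mapping.lookup f w) (E w))"
    by (rule poly_mapping_eqI)
      (auto simp: lookup_sum lookup_lin_smult lookup_E in_keys_iff if_distrib cong: if_cong)
  also have "\<dots> \<in> lin.span (E ` S)"
    using f by (intro lin.span_sum lin.span_scale lin.span_base) auto
  finally show "f \<in> lin.span (E ` S)" .
qed

lemma length_word_insert: "length (word_insert u i v) = length u + length v"
  by (simp add: word_insert_def)

lemma nth_word_insert: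
  assumes "i \<le> length u + 1" "k < length u + length v" "1 \<le> i"
  shows "word_insert u i v ! k =
    (if k < i - 1 then u ! k
     else if k < i - 1 + length v then v ! (k - (i - 1))
     else u ! (k - length v))"
proof -
  obtain a where "i = Suc a" "a \<le> length u"
    using assms(1,3) by (cases i) auto
  then show ?thesis
    using assms by (auto simp: word_insert_def nth_append min_absorb1)
qed

lemma cliffs_iff: "w \<in> cliffs \<rho> \<longleftrightarrow> (\<forall>k < length w. w ! k \<le> \<rho> (Suc k))"
  unfolding cliffs_def letter_def
  by (auto simp: Suc_le_eq) (metis Suc_le_eq Suc_pred diff_Suc_1 zero_less_Suc)

lemma word_insert_cliffs:
  assumes "weakly_increasing \<rho>" "u \<in> cliffs \<rho>" "v \<in> cliffs \<rho>" "1 \<le> i" "i \<le> cliff_size u"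
  shows "word_insert u i v \<in> cliffs \<rho>"
  unfolding cliffs_iff
proof (intro allI impI)
  fix k assume k: "k < length (word_insert u i v)"
  have mono: "\<rho> (Suc a) \<le> \<rho> (Suc b)" if "a \<le> b" for a b
    using assms(1) that unfolding weakly_increasing_def by simp
  have u: "u ! a \<le> \<rho> (Suc k)" if "a < length u" "a \<le> k" for a
    using assms(2) that mono[of a k] unfolding cliffs_iff by (meson order_trans)
  have v: "v ! a \<le> \<rho> (Suc k)" if "a < length v" "a \<le> k" for a
    using assms(3) that mono[of a k] unfolding cliffs_iff by (meson order_trans)
  obtain a where a: "i = Suc a" "a \<le> length u"
    using assms(4,5) by (cases i) (auto simp: cliff_size_def)
  show "word_insert u i v ! k \<le> \<rho> (Suc k)"
    using k a u v
    by (subst nth_word_insert) (auto simp: length_word_insert)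
qed

lemma weakly_increasing_range_bar: "weakly_increasing (range_bar \<delta>)"
  unfolding weakly_increasing_def range_bar_def
  by (intro allI impI Max_mono) auto

lemma word_insert_append: "i = length x + 1 \<Longrightarrow> word_insert (x @ y) i v = x @ v @ y"
  by (simp add: word_insert_def)

lemma split_at:
  assumes "1 \<le> i" "i \<le> cliff_size u"
  obtains x y where "u = x @ y" "i = length x + 1"
proof
  show "u = take (i - 1) u @ drop (i - 1) u" by simp
  show "i = length (take (i - 1) u) + 1" using assms by (simp add: cliff_size_def)
qed

lemma word_insert_sequential:
  assumes "1 \<le> i" "i \<le> cliff_size u" "1 \<le> j" "j \<le> cliff_size v"
  shows "word_insert (word_insert u i v) (i + j - 1) w = word_insert u i (word_insert v j w)"
proof -
  obtain x y where u: "u = x @ y" "i = length x + 1" using split_at assms(1,2) .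
  obtain p q where v: "v = p @ q" "j = length p + 1" using split_at assms(3,4) .
  have "word_insert (word_insert u i v) (i + j - 1) w = word_insert ((x @ p) @ q @ y) (i + j - 1) w"
    using u v by (simp add: word_insert_append)
  also have "\<dots> = (x @ p) @ w @ q @ y"
    using u v by (intro word_insert_append) simp
  also have "\<dots> = word_insert u i (word_insert v j w)"
    using u v by (simp add: word_insert_append)
  finally show ?thesis .
qed

lemma word_insert_parallel:
  assumes "1 \<le> i" "i < j" "j \<le> cliff_size u"
  shows "word_insert (word_insert u i v) (j + cliff_size v - 1) w =
    word_insert (word_insert u j w) i v"
proof -
  have "1 \<le> j" "i \<le> cliff_size u" using assms by auto
  obtain x y where u: "u = x @ y" "i = length x + 1" using split_at assms(1) \<open>i \<le> cliff_size u\<close> .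
  have "1 \<le> j - length x" "j - length x \<le> cliff_size y"
    using assms u by (auto simp: cliff_size_def)
  then obtain p q where y: "y = p @ q" "j - length x = length p + 1" by (rule split_at)
  have j: "j = length (x @ p) + 1" using y assms u by simp
  have "word_insert (word_insert u i v) (j + cliff_size v - 1) w =
      word_insert ((x @ v @ p) @ q) (j + cliff_size v - 1) w"
    using u y by (simp add: word_insert_append)
  also have "\<dots> = (x @ v @ p) @ w @ q"
    using j by (intro word_insert_append) (simp add: cliff_size_def)
  also have "\<dots> = word_insert (x @ p @ w @ q) i v"
    using u by (simp add: word_insert_append)
  also have "x @ p @ w @ q = word_insert u j w"
    using word_insert_append[OF j, of q w] u y by simp
  finally show ?thesis .
qed

lemma ns_operad_cliff_operad:
  assumes \<rho>: "weakly_increasing \<rho>"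
  shows "ns_operad (cliff_operad \<rho> :: ('k::field, nat list \<Rightarrow>\<^sub>0 'k) operad)"
proof -
  define B where "B n = (E :: _ \<Rightarrow> _ \<Rightarrow>\<^sub>0 'k) ` {w \<in> cliffs \<rho>. cliff_size w = n}" for n
  have part: "arity_part (cliff_operad \<rho>) n = lin.span (B n)" for n
    by (simp add: cliff_operad_def B_def)
  have sel: "smult (cliff_operad \<rho>) = (lin_smult :: 'k \<Rightarrow> _)"
      "pcomp (cliff_operad \<rho>) = (lin_pcomp :: (_ \<Rightarrow>\<^sub>0 'k) \<Rightarrow> _)"
      "operad_unit (cliff_operad \<rho>) = (E [] :: _ \<Rightarrow>\<^sub>0 'k)"
    by (simp_all add: cliff_operad_def)
  have BE: "\<exists>w. x = E w \<and> w \<in> cliffs \<rho> \<and> cliff_size w = n" if "x \<in> B n" for x n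
    using that by (auto simp: B_def)
  have keys: "Poly_Mapping.keys f \<subseteq> {w. cliff_size w = n}" if "f \<in> lin.span (B n)" for f n
    using that unfolding B_def span_E_eq by auto
  have closed: "lin_pcomp f i g \<in> lin.span (B (m + n - 1))"
    if f: "f \<in> lin.span (B m)" and g: "g \<in> lin.span (B n)" and i: "1 \<le> i" "i \<le> m" for f g i m n
    using f
  proof (rule lin.span_induct)
    fix x assume x: "x \<in> B m"
    show "lin_pcomp x i g \<in> lin.span (B (m + n - 1))"
      using g
    proof (rule lin.span_induct)
      fix y assume y: "y \<in> B n"
      obtain u v where uv: "x = E u" "u \<in> cliffs \<rho>" "cliff_size u = m"
          "y = E v" "v \<in> cliffs \<rho>" "cliff_size v = n"
        using BE[OF x] BE[OF y] by auto
      then have "word_insert u i v \<in> cliffs \<rho>" "cliff_size (word_insert u i v) = m + n - 1"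
        using word_insert_cliffs[OF \<rho>, of u v i] i
        by (auto simp: cliff_size_def length_word_insert)
      then show "lin_pcomp x i y \<in> lin.span (B (m + n - 1))"
        unfolding uv lin_pcomp_E by (intro lin.span_base) (auto simp: B_def)
    qed (auto simp: lin.subspace_def lin_pcomp_linear lin.span_zero lin.span_add lin.span_scale)
  qed (auto simp: lin.subspace_def lin_pcomp_linear lin.span_zero lin.span_add lin.span_scale)
  have sequential: "lin_pcomp (lin_pcomp f i g) (i + j - 1) h = lin_pcomp f i (lin_pcomp g j h)"
    if f: "f \<in> lin.span (B m)" and g: "g \<in> lin.span (B n)" and h: "h \<in> lin.span (B l)"
      and ij: "1 \<le> i" "i \<le> m" "1 \<le> j" "j \<le> n" for f g h i j l m n
    using f
  proof (rule lin.span_induct)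
    fix x assume x: "x \<in> B m"
    show "lin_pcomp (lin_pcomp x i g) (i + j - 1) h = lin_pcomp x i (lin_pcomp g j h)"
      using g
    proof (rule lin.span_induct)
      fix y assume y: "y \<in> B n"
      show "lin_pcomp (lin_pcomp x i y) (i + j - 1) h = lin_pcomp x i (lin_pcomp y j h)"
        using h
      proof (rule lin.span_induct)
        fix z assume z: "z \<in> B l"
        show "lin_pcomp (lin_pcomp x i y) (i + j - 1) z = lin_pcomp x i (lin_pcomp y j z)"
          using BE[OF x] BE[OF y] BE[OF z] ij
          by (auto simp: lin_pcomp_E word_insert_sequential simp del: One_nat_def)
      qed (auto simp: lin.subspace_def lin_pcomp_linear)
    qed (auto simp: lin.subspace_def lin_pcomp_linear)
  qed (auto simp: lin.subspace_def lin_pcomp_linear)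
  have parallel: "lin_pcomp (lin_pcomp f i g) (j + n - 1) h = lin_pcomp (lin_pcomp f j h) i g"
    if f: "f \<in> lin.span (B m)" and g: "g \<in> lin.span (B n)" and h: "h \<in> lin.span (B l)"
      and ij: "1 \<le> i" "i < j" "j \<le> m" for f g h i j l m n
    using f
  proof (rule lin.span_induct)
    fix x assume x: "x \<in> B m"
    show "lin_pcomp (lin_pcomp x i g) (j + n - 1) h = lin_pcomp (lin_pcomp x j h) i g"
      using g
    proof (rule lin.span_induct)
      fix y assume y: "y \<in> B n"
      show "lin_pcomp (lin_pcomp x i y) (j + n - 1) h = lin_pcomp (lin_pcomp x j h) i y"
        using h
      proof (rule lin.span_induct)
        fix z assume z: "z \<in> B l"
        show "lin_pcomp (lin_pcomp x i y) (j + n - 1) z = lin_pcomp (lin_pcomp x j z) i y"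
          using BE[OF x] BE[OF y] BE[OF z] ij
          by (auto simp: lin_pcomp_E word_insert_parallel simp del: One_nat_def)
      qed (auto simp: lin.subspace_def lin_pcomp_linear)
    qed (auto simp: lin.subspace_def lin_pcomp_linear)
  qed (auto simp: lin.subspace_def lin_pcomp_linear)
  have unit_left: "lin_pcomp (E []) 1 f = f" if "f \<in> lin.span (B m)" for f m
    using that
  proof (rule lin.span_induct)
    fix x assume "x \<in> B m"
    from BE[OF this] show "lin_pcomp (E []) 1 x = x"
      by (auto simp: lin_pcomp_E word_insert_def)
  qed (auto simp: lin.subspace_def lin_pcomp_linear)
  have unit_right: "lin_pcomp f i (E []) = f" if "f \<in> lin.span (B m)" for f m i
    using that
  proof (rule lin.span_induct)
    fix x assume "x \<in> B m"
    from BE[OF this] show "lin_pcomp x i (E []) = x"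
      by (auto simp: lin_pcomp_E word_insert_def)
  qed (auto simp: lin.subspace_def lin_pcomp_linear)
  have direct: "x k = 0"
    if "finite N" "\<forall>n. n \<in> N \<longrightarrow> x n \<in> lin.span (B n)" "(\<Sum>n\<in>N. x n) = 0" "k \<in> N" for N x k
  proof (rule poly_mapping_eqI)
    fix w
    show "Poly_Mapping.lookup (x k) w = Poly_Mapping.lookup 0 w"
    proof (cases "cliff_size w = k")
      case True
      have "Poly_Mapping.lookup (x n) w = 0" if "n \<in> N - {k}" for n
        using keys[of "x n" n] that \<open>\<forall>n. n \<in> N \<longrightarrow> x n \<in> lin.span (B n)\<close> True
        by (auto simp: in_keys_iff)
      then have "(\<Sum>n\<in>N. Poly_Mapping.lookup (x n) w) = Poly_Mapping.lookup (x k) w"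
        using that(1,4) by (simp add: sum.remove[of N k])
      then show ?thesis
        using arg_cong[OF that(3), of "\<lambda>f. Poly_Mapping.lookup f w"] by (simp add: lookup_sum)
    next
      case False
      then show ?thesis
        using keys[of "x k" k] that(2,4) by (auto simp: in_keys_iff)
    qed
  qed
  have unit: "E [] \<in> lin.span (B 1)"
    by (rule lin.span_base) (simp add: B_def cliffs_def cliff_size_def)
  show ?thesis
    unfolding ns_operad_def ns_operad_axioms_def part sel lin_pcomp_linear
    using vector_space_lin_smult closed sequential parallel unit unit_left unit_right direct
    by (intro conjI allI impI lin.subspace_span refl) (blast | erule (3) direct)+
qed

end

theory Submission
  imports Defs
begin

text \<open>
  The space \<open>cliff_V \<delta>\<close> is spanned by basis words, so being an ideal is a closure property of
  words under insertion. A letter violating \<open>\<delta>\<close> at position \<open>k\<close> in a \<open>range_bar \<delta>\<close>-cliff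
  forces \<open>\<delta> j > \<delta> k\<close> for some \<open>j < k\<close>. Insertion only moves letters to the right, and
  if \<open>\<delta>\<close> is unimodal it stays at most \<open>\<delta> k\<close> from \<open>k\<close> on, so the letter remains in
  violation. Conversely, for a valley \<open>\<delta> i1 > \<delta> i2 < \<delta> i3\<close> the word
  \<open>0 \<dots> 0 (\<delta> i2 + 1)\<close> of length \<open>i2\<close> violates \<open>\<delta>\<close>, but padding it with zeros up to
  length \<open>i3\<close> repairs it.
\<close>

lemma E_in_span_E_iff:
  "(E w :: nat list \<Rightarrow>\<^sub>0 'k::field) \<in> lin.span (E ` S) \<longleftrightarrow> w \<in> S"
  by (simp add: span_E_eq keys_E)

lemma lin_pcomp_in_span_E:
  fixes f g :: "nat list \<Rightarrow>\<^sub>0 'k::field"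
  assumes "\<And>u v. \<lbrakk>u \<in> Poly_Mapping.keys f; v \<in> Poly_Mapping.keys g\<rbrakk> \<Longrightarrow> word_insert u i v \<in> S"
  shows "lin_pcomp f i g \<in> lin.span (E ` S)"
  unfolding lin_pcomp_def
  by (intro lin.span_sum lin.span_scale lin.span_base imageI assms)

lemma operad_ideal_span_E_iff:
  assumes \<rho>: "weakly_increasing \<rho>" and S: "S \<subseteq> cliffs \<rho>"
  shows "operad_ideal (cliff_operad \<rho> :: ('k::field, nat list \<Rightarrow>\<^sub>0 'k) operad) (lin.span (E ` S))
    \<longleftrightarrow> (\<forall>u\<in>cliffs \<rho>. \<forall>v\<in>cliffs \<rho>. \<forall>i. 1 \<le> i \<longrightarrow> i \<le> cliff_size u \<longrightarrow> u \<in> S \<or> v \<in> S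
          \<longrightarrow> word_insert u i v \<in> S)"
    (is "operad_ideal ?P ?V \<longleftrightarrow> ?closed")
proof
  have sel: "smult ?P = lin_smult" "pcomp ?P = lin_pcomp"
    "arity_part ?P n = lin.span (E ` {w \<in> cliffs \<rho>. cliff_size w = n})" for n
    by (simp_all add: cliff_operad_def)
  show ?closed if ideal: "operad_ideal ?P ?V"
  proof (intro ballI allI impI)
    fix u v i
    assume uv: "u \<in> cliffs \<rho>" "v \<in> cliffs \<rho>" "1 \<le> i" "i \<le> cliff_size u" "u \<in> S \<or> v \<in> S"
    have "pcomp ?P (E u) i (E v) \<in> ?V"
      using uv by (intro operad_ideal.ideal_pcomp[OF ideal, of _ "cliff_size u" _ "cliff_size v"])
        (auto simp: sel E_in_span_E_iff)
    then show "word_insert u i v \<in> S"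
      by (simp add: sel lin_pcomp_E E_in_span_E_iff)
  qed
  show "operad_ideal ?P ?V" if closed: ?closed
  proof (intro operad_ideal.intro ns_operad_cliff_operad \<rho> operad_ideal_axioms.intro)
    show "module.subspace (smult ?P) ?V"
      by (simp add: sel)
    \<comment> \<open>Gradedness: each spanning vector \<open>E w\<close> is itself homogeneous, of
      arity \<open>cliff_size w\<close>.\<close>
    have "E ` S \<subseteq> (\<Union>n. ?V \<inter> arity_part ?P n)"
      using S by (auto simp: sel E_in_span_E_iff)
    then show "?V \<subseteq> module.span (smult ?P) (\<Union>n. ?V \<inter> arity_part ?P n)"
      unfolding sel(1) by (rule lin.span_mono)
    fix f g m n i
    assume f: "f \<in> arity_part ?P m" and g: "g \<in> arity_part ?P n"
      and i: "1 \<le> i" "i \<le> m" and V: "f \<in> ?V \<or> g \<in> ?V"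
    show "pcomp ?P f i g \<in> ?V"
      unfolding sel
    proof (rule lin_pcomp_in_span_E)
      fix u v assume "u \<in> Poly_Mapping.keys f" "v \<in> Poly_Mapping.keys g"
      \<comment> \<open>If \<open>f\<close> lies in the span then all its keys lie in
        \<open>S\<close>, and likewise for \<open>g\<close>; so the disjunction passes to every pair
        of keys.\<close>
      then have "u \<in> cliffs \<rho>" "v \<in> cliffs \<rho>" "cliff_size u = m" "u \<in> S \<or> v \<in> S"
        using f g V by (auto simp: sel span_E_eq)
      then show "word_insert u i v \<in> S"
        using closed i by blast
    qed
  qed
qed

lemma range_bar_le_iff: "1 \<le> i \<Longrightarrow> range_bar \<delta> i \<le> m \<longleftrightarrow> (\<forall>j\<in>{1..i}. \<delta> j \<le> m)"
  unfolding range_bar_def by (subst Max_le_iff) auto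

lemma le_range_bar: "\<lbrakk>1 \<le> j; j \<le> i\<rbrakk> \<Longrightarrow> \<delta> j \<le> range_bar \<delta> i"
  unfolding range_bar_def by (rule Max_ge) auto

text \<open>The running maximum at \<open>k\<close> is attained at some \<open>j < k\<close>; a
  value above \<open>\<delta> k\<close> after \<open>k\<close> would complete a valley with bottom
  \<open>k\<close>.\<close>

lemma unimodal_antimono_past_drop:
  assumes "unimodal \<delta>" "1 \<le> k" "\<delta> k < range_bar \<delta> k" "k \<le> l"
  shows "\<delta> l \<le> \<delta> k"
proof -
  obtain j where j: "1 \<le> j" "j \<le> k" "\<delta> k < \<delta> j"
    using assms(2,3) range_bar_le_iff[of k \<delta> "\<delta> k"] by (auto simp: not_le)
  then have "j < k" by (cases "j = k") auto
  show ?thesis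
  proof (rule ccontr)
    assume l: "\<not> \<delta> l \<le> \<delta> k"
    with assms(4) have "k < l" by (cases "k = l") auto
    with \<open>j < k\<close> j l assms(1) show False
      unfolding unimodal_def not_le by blast
  qed
qed

text \<open>Isolates what both cases of insertion share: an offending letter recurs at the same or a
  later index. List index \<open>k\<close> is position \<open>Suc k\<close>.\<close>

lemma not_in_cliffs_if_letter_shifted:
  assumes "unimodal \<delta>" "u \<in> cliffs (range_bar \<delta>)" "k < length u" "\<delta> (Suc k) < u ! k"
    and "k \<le> l" "l < length w" "w ! l = u ! k"
  shows "w \<notin> cliffs \<delta>"
proof -
  have "u ! k \<le> range_bar \<delta> (Suc k)"
    using assms(2,3) by (simp add: cliffs_iff)
  with assms(4) have "\<delta> (Suc k) < range_bar \<delta> (Suc k)"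
    by simp
  with assms(1,5) have "\<delta> (Suc l) \<le> \<delta> (Suc k)"
    by (simp add: unimodal_antimono_past_drop)
  then have "\<not> w ! l \<le> \<delta> (Suc l)"
    using assms(4,7) by simp
  with assms(6) show ?thesis
    unfolding cliffs_iff by blast
qed

lemma word_insert_not_in_cliffs:
  assumes "unimodal \<delta>" "u \<in> cliffs (range_bar \<delta>)" "v \<in> cliffs (range_bar \<delta>)"
    and i: "1 \<le> i" "i \<le> cliff_size u" and "u \<notin> cliffs \<delta> \<or> v \<notin> cliffs \<delta>"
  shows "word_insert u i v \<notin> cliffs \<delta>"
  using assms(6)
proof
  assume "u \<notin> cliffs \<delta>"
  then obtain k where k: "k < length u" "\<delta> (Suc k) < u ! k"
    by (auto simp: cliffs_iff not_le)
  show ?thesis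
    \<comment> \<open>Letters of \<open>u\<close> before the insertion point stay put; the others
      move by \<open>length v\<close>.\<close>
    using i k
    by (intro not_in_cliffs_if_letter_shifted[OF assms(1,2) k,
          of "if k < i - 1 then k else k + length v"])
      (auto simp: length_word_insert nth_word_insert cliff_size_def)
next
  assume "v \<notin> cliffs \<delta>"
  then obtain k where k: "k < length v" "\<delta> (Suc k) < v ! k"
    by (auto simp: cliffs_iff not_le)
  show ?thesis
    \<comment> \<open>The letters of \<open>v\<close> land behind the first \<open>i - 1\<close>
      letters of \<open>u\<close>.\<close>
    using i k
    by (intro not_in_cliffs_if_letter_shifted[OF assms(1,3) k, of "i - 1 + k"])
      (auto simp: length_word_insert nth_word_insert cliff_size_def)
qed

lemma replicate_zero_in_cliffs: "replicate n 0 \<in> cliffs \<delta>"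
  by (simp add: cliffs_iff)

lemma zeros_letter_in_cliffs_iff: "replicate n 0 @ [a] \<in> cliffs \<delta> \<longleftrightarrow> a \<le> \<delta> (Suc n)"
  by (auto simp: cliffs_iff nth_append less_Suc_eq)

lemma insert_leaves_complement_if_not_unimodal:
  assumes "\<not> unimodal \<delta>"
  obtains u v where "u \<in> cliffs (range_bar \<delta>) - cliffs \<delta>" "v \<in> cliffs (range_bar \<delta>)"
    "word_insert u 1 v \<in> cliffs \<delta>"
proof -
  obtain a b c where abc: "1 \<le> a" "a < b" "b < c" "\<delta> b < \<delta> a" "\<delta> b < \<delta> c"
    using assms unfolding unimodal_def by blast
  \<comment> \<open>\<open>Suc (\<delta> b)\<close> is the least letter forbidden at
    \<open>b\<close>, so it is at most both \<open>\<delta> a\<close> and \<open>\<delta> c\<close>.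
    The \<open>c - b\<close> zeros of \<open>v\<close>, put in front, carry it to position
    \<open>c\<close>.\<close>
  define u where "u = replicate (b - 1) 0 @ [Suc (\<delta> b)]"
  define v :: "nat list" where "v = replicate (c - b) 0"
  have "\<delta> a \<le> range_bar \<delta> b"
    using abc by (intro le_range_bar) auto
  then have "u \<in> cliffs (range_bar \<delta>) - cliffs \<delta>"
    using abc by (simp add: u_def zeros_letter_in_cliffs_iff)
  moreover have "word_insert u 1 v = replicate (c - 1) 0 @ [Suc (\<delta> b)]"
    using abc by (simp add: u_def v_def word_insert_def flip: append_assoc replicate_add)
  then have "word_insert u 1 v \<in> cliffs \<delta>"
    using abc by (simp add: zeros_letter_in_cliffs_iff)
  ultimately show thesis
    using that replicate_zero_in_cliffs v_def by blast
qed

theorem proposition2p1p1: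
  fixes \<delta> :: "nat \<Rightarrow> nat"
  shows "operad_ideal (cliff_operad (range_bar \<delta>) :: ('k::field_char_0, nat list \<Rightarrow>\<^sub>0 'k) operad)
           (cliff_V \<delta>)
         \<longleftrightarrow> unimodal \<delta>"
  unfolding cliff_V_def
    operad_ideal_span_E_iff[OF weakly_increasing_range_bar[of \<delta>] Diff_subset]
proof
  assume closed: "\<forall>u\<in>cliffs (range_bar \<delta>). \<forall>v\<in>cliffs (range_bar \<delta>). \<forall>i.
    1 \<le> i \<longrightarrow> i \<le> cliff_size u \<longrightarrow>
    u \<in> cliffs (range_bar \<delta>) - cliffs \<delta> \<or> v \<in> cliffs (range_bar \<delta>) - cliffs \<delta> \<longrightarrow>
    word_insert u i v \<in> cliffs (range_bar \<delta>) - cliffs \<delta>"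
  show "unimodal \<delta>"
  proof (rule ccontr)
    assume "\<not> unimodal \<delta>"
    then obtain u v where "u \<in> cliffs (range_bar \<delta>) - cliffs \<delta>" "v \<in> cliffs (range_bar \<delta>)"
      "word_insert u 1 v \<in> cliffs \<delta>"
      by (rule insert_leaves_complement_if_not_unimodal)
    moreover have "1 \<le> cliff_size u"
      by (simp add: cliff_size_def)
    ultimately show False
      using closed by blast
  qed
next
  assume "unimodal \<delta>"
  then show "\<forall>u\<in>cliffs (range_bar \<delta>). \<forall>v\<in>cliffs (range_bar \<delta>). \<forall>i.
    1 \<le> i \<longrightarrow> i \<le> cliff_size u \<longrightarrow>
    u \<in> cliffs (range_bar \<delta>) - cliffs \<delta> \<or> v \<in> cliffs (range_bar \<delta>) - cliffs \<delta> \<longrightarrow>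
    word_insert u i v \<in> cliffs (range_bar \<delta>) - cliffs \<delta>"
    by (intro ballI allI impI DiffI word_insert_cliffs[OF weakly_increasing_range_bar]
        word_insert_not_in_cliffs) auto
qed

end
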